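(* Let $R$ be a commutative ring. If $(A,d)$ is a dg-Artinian acyclic differential graded $R$-algebra, then $(A,d)$ is dg-Noetherian.
   Context: A differential graded (dg) $R$-algebra $(A,d)$ is a $\mathbb{Z}$-graded $R$-algebra $A$ with an $R$-linear endomorphism $d$, homogeneous of degree $1$, with $d^2=0$ and $d(ab)=d(a)b+(-1)^{|a|}a\,d(b)$ for homogeneous $a,b$. It is acyclic if $\ker(d)=\operatorname{im}(d)$. A dg-ideal is a graded ideal $I$ with $d(I)\subseteq I$; $(A,d)$ is dg-Noetherian (resp. dg-Artinian) if it satisfies the ascending (resp. descending) chain condition on dg-ideals (i.e. on dg-submodules of $A$ viewed as a dg-module over itself). *)

theory Defs
  imports Main
begin

definition graded_decomp :: "(int \<Rightarrow> 'a::ring_1 set) \<Rightarrow> 'a \<Rightarrow> (int \<Rightarrow> 'a) \<Rightarrow> bool" where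
  "graded_decomp G a c \<longleftrightarrow>
     finite {n. c n \<noteq> 0} \<and> (\<forall>n. c n \<in> G n) \<and> a = (\<Sum>n\<in>{n. c n \<noteq> 0}. c n)"

definition r_algebra :: "('r::comm_ring_1 \<Rightarrow> 'a::ring_1 \<Rightarrow> 'a) \<Rightarrow> bool" where
  "r_algebra sm \<longleftrightarrow>
     (\<forall>r a b. sm r (a + b) = sm r a + sm r b) \<and>
     (\<forall>r s a. sm (r + s) a = sm r a + sm s a) \<and>
     (\<forall>r s a. sm (r * s) a = sm r (sm s a)) \<and>
     (\<forall>a. sm 1 a = a) \<and>
     (\<forall>r a b. sm r (a * b) = sm r a * b \<and> sm r (a * b) = a * sm r b)"

definition graded_r_algebra :: "('r::comm_ring_1 \<Rightarrow> 'a::ring_1 \<Rightarrow> 'a) \<Rightarrow> (int \<Rightarrow> 'a set) \<Rightarrow> bool" where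
  "graded_r_algebra sm G \<longleftrightarrow>
     r_algebra sm \<and>
     (\<forall>n. 0 \<in> G n \<and> (\<forall>a\<in>G n. \<forall>b\<in>G n. a + b \<in> G n) \<and> (\<forall>a\<in>G n. - a \<in> G n)
          \<and> (\<forall>r. \<forall>a\<in>G n. sm r a \<in> G n)) \<and>
     (\<forall>a. \<exists>!c. graded_decomp G a c) \<and>
     (\<forall>m n. \<forall>a\<in>G m. \<forall>b\<in>G n. a * b \<in> G (m + n))"

definition dg_algebra ::
  "('r::comm_ring_1 \<Rightarrow> 'a::ring_1 \<Rightarrow> 'a) \<Rightarrow> (int \<Rightarrow> 'a set) \<Rightarrow> ('a \<Rightarrow> 'a) \<Rightarrow> bool" where
  "dg_algebra sm G d \<longleftrightarrow>
     graded_r_algebra sm G \<and>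
     (\<forall>a b. d (a + b) = d a + d b) \<and>
     (\<forall>r a. d (sm r a) = sm r (d a)) \<and>
     (\<forall>n. \<forall>a\<in>G n. d a \<in> G (n + 1)) \<and>
     (\<forall>a. d (d a) = 0) \<and>
     (\<forall>m n. \<forall>a\<in>G m. \<forall>b\<in>G n. d (a * b) = d a * b + (- 1) ^ nat \<bar>m\<bar> * a * d b)"

definition dg_acyclic :: "('a::ring_1 \<Rightarrow> 'a) \<Rightarrow> bool" where
  "dg_acyclic d \<longleftrightarrow> {a. d a = 0} = range d"

definition dg_ideal :: "(int \<Rightarrow> 'a::ring_1 set) \<Rightarrow> ('a \<Rightarrow> 'a) \<Rightarrow> 'a set \<Rightarrow> bool" where
  "dg_ideal G d I \<longleftrightarrow>
     0 \<in> I \<and> (\<forall>x\<in>I. \<forall>y\<in>I. x + y \<in> I) \<and> (\<forall>x\<in>I. - x \<in> I) \<and>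
     (\<forall>a. \<forall>x\<in>I. a * x \<in> I) \<and>
     (\<forall>x\<in>I. \<exists>c. graded_decomp G x c \<and> (\<forall>n. c n \<in> I)) \<and>
     (\<forall>x\<in>I. d x \<in> I)"

definition dg_noetherian :: "(int \<Rightarrow> 'a::ring_1 set) \<Rightarrow> ('a \<Rightarrow> 'a) \<Rightarrow> bool" where
  "dg_noetherian G d \<longleftrightarrow>
     (\<forall>I :: nat \<Rightarrow> 'a set. (\<forall>k. dg_ideal G d (I k)) \<and> (\<forall>k. I k \<subseteq> I (Suc k))
        \<longrightarrow> (\<exists>N. \<forall>k\<ge>N. I k = I N))"

definition dg_artinian :: "(int \<Rightarrow> 'a::ring_1 set) \<Rightarrow> ('a \<Rightarrow> 'a) \<Rightarrow> bool" where
  "dg_artinian G d \<longleftrightarrow>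
     (\<forall>I :: nat \<Rightarrow> 'a set. (\<forall>k. dg_ideal G d (I k)) \<and> (\<forall>k. I (Suc k) \<subseteq> I k)
        \<longrightarrow> (\<exists>N. \<forall>k\<ge>N. I k = I N))"

end

theory Submission
  imports Defs
begin

text \<open>
Since 1 is a cycle, acyclicity gives an element u of degree -1 with d u = 1, and then
x = d (u x) + u d x for all x. Hence a dg-ideal I is determined by its cycles, and I maps to
I \<inter> ker d bijectively onto the graded left ideals of the graded ring Z = ker d. It remains to show
that a graded left Artinian ring Z is graded left Noetherian.

Let L be minimal among the non-Noetherian graded left ideals. Then L is not cyclic and is not the sum
of two proper graded subideals. Let K be minimal with K L = L. As K inherits the indecomposability of
L and K K = K, one finds k \<in> K of degree 0 and x \<noteq> 0 with k x = x, and K = K k + K (1 - k) forces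
K = Z k. Let T be a maximal graded subideal of K; then T L \<noteq> L by minimality of K. Since K / T is
simple, L / T L is a sum of simple modules, so L = Z l + C for some l and some proper C, a
contradiction.
\<close>

section \<open>Graded left ideals of a graded ring\<close>

text \<open>The grading is carried by projections \<open>p n\<close> on the whole ambient ring, so
  homogeneity of degree \<open>n\<close> is the equation \<open>p n x = x\<close> and the cycles of
  a dg-algebra fit without a type of their own.\<close>

locale graded_subring =
  fixes Z :: "'a::ring_1 set" and p :: "int \<Rightarrow> 'a \<Rightarrow> 'a"
  assumes one_Z: "1 \<in> Z"
    and diff_Z: "x \<in> Z \<Longrightarrow> y \<in> Z \<Longrightarrow> x - y \<in> Z"
    and mult_Z: "x \<in> Z \<Longrightarrow> y \<in> Z \<Longrightarrow> x * y \<in> Z"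
    and comp_Z: "x \<in> Z \<Longrightarrow> p n x \<in> Z"
    and comp_add: "p n (x + y) = p n x + p n y"
    and finite_comp: "finite {n. p n x \<noteq> 0}"
    and sum_comp: "(\<Sum>n\<in>{n. p n x \<noteq> 0}. p n x) = x"
    and comp_comp: "p m (p n x) = (if m = n then p n x else 0)"
    and comp_one: "p 0 1 = 1"
    and comp_mult_left: "p n (p i x * y) = p i x * p (n - i) y"
    and comp_mult_right: "p n (x * p j y) = p (n - j) x * p j y"
begin

lemma comp_zero [simp]: "p n 0 = 0"
  using comp_add[of n 0 0] by simp

lemma comp_minus: "p n (- x) = - p n x"
  using comp_add[of n x "- x"] by (simp add: eq_neg_iff_add_eq_0 add.commute)

lemma comp_diff: "p n (x - y) = p n x - p n y"
  using comp_add[of n x "- y"] by (simp add: comp_minus)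

lemma comp_mult_homogeneous_right: "p j y = y \<Longrightarrow> p n (x * y) = p (n - j) x * y"
  using comp_mult_right[of n x j y] by simp

lemma comp_sum: "p n (\<Sum>i\<in>F. f i) = (\<Sum>i\<in>F. p n (f i))"
  by (induction F rule: infinite_finite_induct) (auto simp: comp_add)

definition gideal :: "'a set \<Rightarrow> bool" where
  "gideal I \<longleftrightarrow> I \<subseteq> Z \<and> 0 \<in> I \<and> (\<forall>x\<in>I. \<forall>y\<in>I. x - y \<in> I) \<and>
     (\<forall>a\<in>Z. \<forall>x\<in>I. a * x \<in> I) \<and> (\<forall>n. \<forall>x\<in>I. p n x \<in> I)"

lemma gidealI:
  assumes "I \<subseteq> Z" "0 \<in> I" "\<And>x y. x \<in> I \<Longrightarrow> y \<in> I \<Longrightarrow> x - y \<in> I"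
    "\<And>a x. a \<in> Z \<Longrightarrow> x \<in> I \<Longrightarrow> a * x \<in> I" "\<And>n x. x \<in> I \<Longrightarrow> p n x \<in> I"
  shows "gideal I"
  using assms unfolding gideal_def by blast

lemma
  assumes "gideal I"
  shows gideal_subset: "I \<subseteq> Z" and gideal_zero: "0 \<in> I"
    and gideal_diff: "x \<in> I \<Longrightarrow> y \<in> I \<Longrightarrow> x - y \<in> I"
    and gideal_mult: "a \<in> Z \<Longrightarrow> x \<in> I \<Longrightarrow> a * x \<in> I"
    and gideal_comp: "x \<in> I \<Longrightarrow> p n x \<in> I"
  using assms unfolding gideal_def by blast+

lemma gideal_minus: "gideal I \<Longrightarrow> x \<in> I \<Longrightarrow> - x \<in> I"
  using gideal_diff[of I 0 x] gideal_zero by simp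

lemma gideal_add: "gideal I \<Longrightarrow> x \<in> I \<Longrightarrow> y \<in> I \<Longrightarrow> x + y \<in> I"
  using gideal_diff[of I x "- y"] gideal_minus by simp

lemma gideal_sum: "gideal I \<Longrightarrow> (\<And>i. i \<in> F \<Longrightarrow> f i \<in> I) \<Longrightarrow> (\<Sum>i\<in>F. f i) \<in> I"
  by (induction F rule: infinite_finite_induct) (auto simp: gideal_add gideal_zero)

lemma gideal_of_comps: "gideal I \<Longrightarrow> (\<And>n. p n x \<in> I) \<Longrightarrow> x \<in> I"
  using gideal_sum[of I "{n. p n x \<noteq> 0}" "\<lambda>n. p n x"] sum_comp by simp

lemma gideal_Z: "gideal Z"
  by (rule gidealI) (use one_Z diff_Z[OF one_Z one_Z] diff_Z mult_Z comp_Z in auto)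

lemma gideal_inter: "gideal I \<Longrightarrow> gideal J \<Longrightarrow> gideal (I \<inter> J)"
  unfolding gideal_def by blast

lemma gideal_Union_chain:
  assumes "S \<noteq> {}" "\<And>I. I \<in> S \<Longrightarrow> gideal I"
    "\<And>I J. I \<in> S \<Longrightarrow> J \<in> S \<Longrightarrow> I \<subseteq> J \<or> J \<subseteq> I"
  shows "gideal (\<Union>S)"
proof (rule gidealI)
  fix x y assume "x \<in> \<Union>S" "y \<in> \<Union>S"
  then obtain I where "I \<in> S" "x \<in> I" "y \<in> I" using assms(3) by blast
  then show "x - y \<in> \<Union>S" using assms(2) gideal_diff by blast
next
  show "0 \<in> \<Union>S" using assms(1,2) gideal_zero by blast
qed (use assms(2) gideal_subset gideal_mult gideal_comp in blast)+

section \<open>Sums of graded left ideals, and cyclic ideals\<close>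

definition plus_ideal :: "'a set \<Rightarrow> 'a set \<Rightarrow> 'a set" where
  "plus_ideal I J = {x + y | x y. x \<in> I \<and> y \<in> J}"

lemma plus_idealI: "x \<in> I \<Longrightarrow> y \<in> J \<Longrightarrow> x + y \<in> plus_ideal I J"
  unfolding plus_ideal_def by blast

lemma plus_idealE:
  assumes "z \<in> plus_ideal I J" obtains x y where "x \<in> I" "y \<in> J" "z = x + y"
  using assms unfolding plus_ideal_def by blast

lemma gideal_plus:
  assumes "gideal I" "gideal J" shows "gideal (plus_ideal I J)"
proof (rule gidealI)
  show "plus_ideal I J \<subseteq> Z"
    by (auto elim!: plus_idealE intro!: gideal_add[OF gideal_Z] dest: subsetD[OF gideal_subset[OF assms(1)]]
        subsetD[OF gideal_subset[OF assms(2)]])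
  show "0 \<in> plus_ideal I J"
    using plus_idealI[of 0 I 0 J] assms gideal_zero by simp
next
  fix x y assume "x \<in> plus_ideal I J" "y \<in> plus_ideal I J"
  then obtain a b a' b' where *: "a \<in> I" "b \<in> J" "x = a + b" "a' \<in> I" "b' \<in> J" "y = a' + b'"
    by (auto elim!: plus_idealE)
  then have "x - y = (a - a') + (b - b')" by simp
  then show "x - y \<in> plus_ideal I J"
    using plus_idealI[OF gideal_diff[OF assms(1) *(1,4)] gideal_diff[OF assms(2) *(2,5)]] by simp
next
  fix a x assume "a \<in> Z" "x \<in> plus_ideal I J"
  then show "a * x \<in> plus_ideal I J"
    using gideal_mult[OF assms(1)] gideal_mult[OF assms(2)]
    by (auto simp: distrib_left elim!: plus_idealE intro!: plus_idealI)
next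
  fix n x assume "x \<in> plus_ideal I J"
  then show "p n x \<in> plus_ideal I J"
    using gideal_comp[OF assms(1)] gideal_comp[OF assms(2)]
    by (auto simp: comp_add elim!: plus_idealE intro!: plus_idealI)
qed

lemma plus_ideal_left: "gideal J \<Longrightarrow> x \<in> I \<Longrightarrow> x \<in> plus_ideal I J"
  using plus_idealI[of x I 0 J] gideal_zero by simp

lemma plus_ideal_right: "gideal I \<Longrightarrow> x \<in> J \<Longrightarrow> x \<in> plus_ideal I J"
  using plus_idealI[of 0 I x J] gideal_zero by simp

lemma plus_ideal_subset: "gideal M \<Longrightarrow> I \<subseteq> M \<Longrightarrow> J \<subseteq> M \<Longrightarrow> plus_ideal I J \<subseteq> M"
  by (auto elim!: plus_idealE intro!: gideal_add)

text \<open>Homogeneity of \<open>x\<close> makes this work: the degree \<open>n\<close> component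
  of \<open>a * x\<close> is \<open>p (n - m) a * x\<close>, again with coefficient in
  \<open>K\<close>. For \<open>K = Z\<close> these are the cyclic graded ideals.\<close>

lemma gideal_mult_right:
  assumes K: "gideal K" and x: "x \<in> Z" "p m x = x"
  shows "gideal ((\<lambda>a. a * x) ` K)"
proof (rule gidealI)
  show "(\<lambda>a. a * x) ` K \<subseteq> Z" using gideal_subset[OF K] x mult_Z by auto
  show "0 \<in> (\<lambda>a. a * x) ` K" using gideal_zero[OF K] by force
next
  fix y z assume "y \<in> (\<lambda>a. a * x) ` K" "z \<in> (\<lambda>a. a * x) ` K"
  then show "y - z \<in> (\<lambda>a. a * x) ` K"
    using gideal_diff[OF K] by (auto simp: image_iff left_diff_distrib[symmetric])
next
  fix a y assume "a \<in> Z" "y \<in> (\<lambda>a. a * x) ` K"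
  then show "a * y \<in> (\<lambda>a. a * x) ` K"
    using gideal_mult[OF K] by (auto simp: image_iff mult.assoc[symmetric])
next
  fix n y assume "y \<in> (\<lambda>a. a * x) ` K"
  then show "p n y \<in> (\<lambda>a. a * x) ` K"
    using gideal_comp[OF K] comp_mult_homogeneous_right[OF x(2)] by (auto simp: image_iff)
qed

lemma self_mem_cyclic: "x \<in> (\<lambda>a. a * x) ` Z"
  by (rule image_eqI[OF _ one_Z]) simp

section \<open>Products of graded left ideals\<close>

inductive_set prod_ideal :: "'a set \<Rightarrow> 'a set \<Rightarrow> 'a set" for K L where
  zero: "0 \<in> prod_ideal K L"
| mult: "a \<in> K \<Longrightarrow> b \<in> L \<Longrightarrow> a * b \<in> prod_ideal K L"
| add: "x \<in> prod_ideal K L \<Longrightarrow> y \<in> prod_ideal K L \<Longrightarrow> x + y \<in> prod_ideal K L"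

lemma prod_ideal_subset:
  assumes "gideal M" "\<And>a b. a \<in> K \<Longrightarrow> b \<in> L \<Longrightarrow> a * b \<in> M"
  shows "prod_ideal K L \<subseteq> M"
proof
  fix x assume "x \<in> prod_ideal K L"
  then show "x \<in> M" by induction (use assms gideal_zero gideal_add in auto)
qed

lemma prod_ideal_sum:
  "(\<And>i. i \<in> F \<Longrightarrow> f i \<in> prod_ideal K L) \<Longrightarrow> (\<Sum>i\<in>F. f i) \<in> prod_ideal K L"
  by (induction F rule: infinite_finite_induct) (auto intro: prod_ideal.intros)

lemma gideal_prod:
  assumes K: "gideal K" and L: "gideal L"
  shows "gideal (prod_ideal K L)"
proof (rule gidealI)
  show "prod_ideal K L \<subseteq> Z"
    by (rule prod_ideal_subset[OF gideal_Z]) (use gideal_subset[OF K] gideal_subset[OF L] mult_Z in auto)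
  show "0 \<in> prod_ideal K L" by (rule prod_ideal.zero)
next
  fix x y assume x: "x \<in> prod_ideal K L" and "y \<in> prod_ideal K L"
  from this(2) have "- y \<in> prod_ideal K L"
  proof induction
    case (mult a b)
    then show ?case using prod_ideal.mult[of "- a" K b L] gideal_minus[OF K] by simp
  next
    case (add x y)
    then show ?case using prod_ideal.add[of "- x" K L "- y"] by simp
  qed (simp add: prod_ideal.zero)
  then show "x - y \<in> prod_ideal K L" using prod_ideal.add[OF x, of "- y"] by simp
next
  fix a x assume a: "a \<in> Z" and "x \<in> prod_ideal K L"
  from this(2) show "a * x \<in> prod_ideal K L"
  proof induction
    case (mult b c)
    then show ?case using prod_ideal.mult[of "a * b" K c L] gideal_mult[OF K a] by (simp add: mult.assoc)
  qed (auto simp: distrib_left intro: prod_ideal.intros)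
next
  fix n x assume "x \<in> prod_ideal K L"
  then show "p n x \<in> prod_ideal K L"
  proof induction
    case (mult a b)
    have "a * b = (\<Sum>i\<in>{i. p i a \<noteq> 0}. p i a * b)"
      by (simp add: sum_comp sum_distrib_right[symmetric])
    then have "p n (a * b) = (\<Sum>i\<in>{i. p i a \<noteq> 0}. p i a * p (n - i) b)"
      by (simp add: comp_sum comp_mult_left)
    also have "\<dots> \<in> prod_ideal K L"
      by (intro prod_ideal_sum prod_ideal.mult gideal_comp[OF K] gideal_comp[OF L] mult)
    finally show ?case .
  qed (auto simp: comp_add intro: prod_ideal.intros)
qed

text \<open>Zorn's lemma. If \<open>v\<close> generates \<open>M\<close>, then \<open>C\<close> is a
  maximal proper graded subideal; if \<open>M / B\<close> is semisimple and \<open>v\<close> is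
  homogeneous and generates a simple submodule of it, then \<open>C\<close> is a complement of that
  submodule modulo \<open>B\<close>.\<close>

lemma exists_maximal_gideal_avoiding:
  assumes B: "gideal B" "B \<subseteq> M" "v \<notin> B"
  shows "\<exists>C. gideal C \<and> B \<subseteq> C \<and> C \<subseteq> M \<and> v \<notin> C \<and>
    (\<forall>D. gideal D \<longrightarrow> C \<subseteq> D \<longrightarrow> D \<subseteq> M \<longrightarrow> v \<notin> D \<longrightarrow> D = C)"
proof -
  let ?F = "{C. gideal C \<and> B \<subseteq> C \<and> C \<subseteq> M \<and> v \<notin> C}"
  have "\<exists>C\<in>?F. \<forall>D\<in>?F. C \<subseteq> D \<longrightarrow> D = C"
  proof (rule subset_Zorn_nonempty)
    show "?F \<noteq> {}" using B by blast
  next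
    fix S assume S: "S \<noteq> {}" "subset.chain ?F S"
    then have "gideal (\<Union>S)"
      by (intro gideal_Union_chain) (auto simp: subset_chain_def)
    then show "\<Union>S \<in> ?F" using S unfolding subset_chain_def by blast
  qed
  then obtain C where C: "C \<in> ?F" and max: "\<forall>D\<in>?F. C \<subseteq> D \<longrightarrow> D = C" by (rule bexE)
  have "gideal C" "B \<subseteq> C" "C \<subseteq> M" "v \<notin> C" using C by auto
  moreover have "D = C" if "gideal D" "C \<subseteq> D" "D \<subseteq> M" "v \<notin> D" for D
    using that max \<open>B \<subseteq> C\<close> by simp
  ultimately show ?thesis by auto
qed

section \<open>The graded Hopkins theorem\<close>

definition noeth :: "'a set \<Rightarrow> bool" where
  "noeth M \<longleftrightarrow> (\<forall>I :: nat \<Rightarrow> 'a set. (\<forall>k. gideal (I k) \<and> I k \<subseteq> M) \<and> (\<forall>k. I k \<subseteq> I (Suc k))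
     \<longrightarrow> (\<exists>N. \<forall>k\<ge>N. I k = I N))"

text \<open>The usual extension argument without quotients: \<open>I k \<inter> A\<close> records
  the part of \<open>I k\<close> inside \<open>A\<close>, and
  \<open>plus_ideal (I k) A \<inter> B\<close> its image modulo \<open>A\<close>. Once both are
  constant, so is the chain.\<close>

lemma noeth_plus:
  assumes A: "gideal A" "noeth A" and B: "gideal B" "noeth B"
  shows "noeth (plus_ideal A B)"
  unfolding noeth_def
proof (intro allI impI, elim conjE)
  fix I :: "nat \<Rightarrow> 'a set"
  assume I: "\<forall>k. gideal (I k) \<and> I k \<subseteq> plus_ideal A B" and inc: "\<forall>k. I k \<subseteq> I (Suc k)"
  have gI: "gideal (I k)" for k using I by blast
  have "\<exists>N. \<forall>k\<ge>N. I k \<inter> A = I N \<inter> A"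
    using A(2)[unfolded noeth_def, rule_format, of "\<lambda>k. I k \<inter> A"] gI A(1) gideal_inter inc by blast
  then obtain N1 where N1: "\<And>k. k \<ge> N1 \<Longrightarrow> I k \<inter> A = I N1 \<inter> A" by blast
  have "plus_ideal (I k) A \<inter> B \<subseteq> plus_ideal (I (Suc k)) A \<inter> B" for k
    using inc unfolding plus_ideal_def by blast
  then have "\<exists>N. \<forall>k\<ge>N. plus_ideal (I k) A \<inter> B = plus_ideal (I N) A \<inter> B"
    using B(2)[unfolded noeth_def, rule_format, of "\<lambda>k. plus_ideal (I k) A \<inter> B"]
      gI A(1) B(1) gideal_inter gideal_plus by blast
  then obtain N2 where N2: "\<And>k. k \<ge> N2 \<Longrightarrow> plus_ideal (I k) A \<inter> B = plus_ideal (I N2) A \<inter> B" by blast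
  let ?N = "max N1 N2"
  have "I k = I ?N" if k: "k \<ge> ?N" for k
  proof
    show "I ?N \<subseteq> I k" using lift_Suc_mono_le[of I ?N k] inc k by blast
  next
    have NA: "I k \<inter> A = I ?N \<inter> A" using N1[of k] N1[of ?N] k by auto
    have NB: "plus_ideal (I k) A \<inter> B = plus_ideal (I ?N) A \<inter> B" using N2[of k] N2[of ?N] k by auto
    have le: "I ?N \<subseteq> I k" using lift_Suc_mono_le[of I ?N k] inc k by blast
    show "I k \<subseteq> I ?N"
    proof
      fix x assume x: "x \<in> I k"
      then have "x \<in> plus_ideal A B" using I by blast
      then obtain a b where ab: "a \<in> A" "b \<in> B" "x = a + b" by (rule plus_idealE)
      \<comment> \<open>Stability of the second chain replaces \<open>b\<close> by some
        \<open>y\<close> in \<open>I ?N\<close> up to an element of \<open>A\<close>; then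
        \<open>x - y\<close> lies in \<open>I k \<inter> A\<close>, where the first chain is
        stable.\<close>
      have "b = x + (- a)" using ab by simp
      then have "b \<in> plus_ideal (I k) A" using plus_idealI[OF x gideal_minus[OF A(1) ab(1)]] by simp
      then have "b \<in> plus_ideal (I ?N) A" using NB ab(2) by blast
      then obtain y a' where ya: "y \<in> I ?N" "a' \<in> A" "b = y + a'" by (rule plus_idealE)
      have "x - y = a + a'" using ab ya by simp
      then have "x - y \<in> I k \<inter> A"
        using gideal_diff[OF gI x, of y] ya le gideal_add[OF A(1) ab(1) ya(2)] by auto
      then have "x - y \<in> I ?N" using NA by blast
      then show "x \<in> I ?N" using gideal_add[OF gI ya(1), of "x - y"] by simp
    qed
  qed
  then show "\<exists>N. \<forall>k\<ge>N. I k = I N" by blast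
qed

text \<open>A graded form of the classical search for idempotents in non-nilpotent left ideals: a
  nonzero \<open>x\<close> with \<open>k * x = x\<close> keeps \<open>K (1 - k)\<close> proper, and
  indecomposability then leaves only \<open>K k = K\<close>. The assumption \<open>minimal\<close>
  is the descending chain condition as a minimum principle.\<close>

lemma minimal_multiplier_cyclic:
  fixes K L
  assumes K: "gideal K" and L: "gideal L"
    and KL: "prod_ideal K L = L" and L0: "L \<noteq> {0}"
    and minK: "\<And>T. gideal T \<Longrightarrow> T \<subseteq> K \<Longrightarrow> prod_ideal T L = L \<Longrightarrow> T = K"
    and hollow: "\<And>A B. gideal A \<Longrightarrow> gideal B \<Longrightarrow> plus_ideal A B = L \<Longrightarrow> A = L \<or> B = L"
    and minimal: "\<And>P. (\<exists>I. gideal I \<and> P I) \<Longrightarrow>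
      \<exists>I. gideal I \<and> P I \<and> (\<forall>J. gideal J \<longrightarrow> P J \<longrightarrow> J \<subseteq> I \<longrightarrow> J = I)"
  obtains k where "k \<in> K" "p 0 k = k" "K = (\<lambda>a. a * k) ` Z"
proof -
  have TL_sub: "prod_ideal T L \<subseteq> L" if "T \<subseteq> K" for T
    by (rule prod_ideal_subset[OF L]) (use gideal_mult[OF L] gideal_subset[OF K] that in blast)
  \<comment> \<open>From \<open>K \<subseteq> T1 + T2\<close> follows
    \<open>L = K L = T1 L + T2 L\<close>, so one summand is all of \<open>L\<close>, and minimality
    of \<open>K\<close> identifies the corresponding \<open>Ti\<close> with
    \<open>K\<close>.\<close>
  have hollowK: "T1 = K \<or> T2 = K"
    if T: "gideal T1" "gideal T2" "T1 \<subseteq> K" "T2 \<subseteq> K" "K \<subseteq> plus_ideal T1 T2" for T1 T2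
  proof -
    let ?S = "plus_ideal (prod_ideal T1 L) (prod_ideal T2 L)"
    have g: "gideal (prod_ideal T1 L)" "gideal (prod_ideal T2 L)" using T gideal_prod L by auto
    have "prod_ideal K L \<subseteq> ?S"
    proof (rule prod_ideal_subset)
      show "gideal ?S" using g gideal_plus by blast
      fix a b assume "a \<in> K" "b \<in> L"
      from subsetD[OF T(5) this(1)] obtain t1 t2 where "t1 \<in> T1" "t2 \<in> T2" "a = t1 + t2"
        by (rule plus_idealE)
      then show "a * b \<in> ?S"
        using \<open>b \<in> L\<close> by (auto simp: distrib_right intro!: plus_idealI prod_ideal.mult)
    qed
    moreover have "?S \<subseteq> L" by (intro plus_ideal_subset L TL_sub T(3,4))
    ultimately have "?S = L" using KL by simp
    then have "prod_ideal T1 L = L \<or> prod_ideal T2 L = L" by (rule hollow[OF g])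
    then show ?thesis using minK[OF T(1,3)] minK[OF T(2,4)] by iprover
  qed
  \<comment> \<open>Associativity gives \<open>(K K) L = K (K L) = L\<close>, so minimality of
    \<open>K\<close> applies to \<open>K K\<close>.\<close>
  have KK: "prod_ideal K K = K"
  proof (rule minK)
    show "gideal (prod_ideal K K)" by (rule gideal_prod[OF K K])
    show KKs: "prod_ideal K K \<subseteq> K"
      using prod_ideal_subset[OF K] gideal_mult[OF K] gideal_subset[OF K] by blast
    have "a * b \<in> prod_ideal (prod_ideal K K) L" if a: "a \<in> K" and b: "b \<in> L" for a b
    proof -
      have "b \<in> prod_ideal K L" using KL b by simp
      then show ?thesis
      proof induction
        case (mult c e)
        then show ?case
          using prod_ideal.mult[OF prod_ideal.mult[OF a mult(1)] mult(2)] by (simp add: mult.assoc)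
      qed (auto simp: distrib_left intro: prod_ideal.intros)
    qed
    then have "L \<subseteq> prod_ideal (prod_ideal K K) L"
      using prod_ideal_subset[OF gideal_prod[OF gideal_prod[OF K K] L], of K L] KL by simp
    then show "prod_ideal (prod_ideal K K) L = L" using TL_sub[OF KKs] by blast
  qed
  \<comment> \<open>A minimal graded ideal \<open>S\<close> not annihilated by \<open>K\<close> will
    turn out to be \<open>K x\<close> for some \<open>x\<close> in \<open>S\<close>, which yields
    \<open>k0\<close> in \<open>K\<close> with \<open>k0 * x = x\<close>.\<close>
  define P where "P S \<longleftrightarrow> (\<exists>a\<in>K. \<exists>x\<in>S. a * x \<noteq> 0)" for S
  have "P L"
  proof (rule ccontr)
    assume "\<not> P L"
    then have *: "b * c = 0" if "b \<in> K" "c \<in> L" for b c using that by (auto simp: P_def)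
    have "x = 0" if "x \<in> prod_ideal K L" for x
      using that by induction (auto simp: *)
    then show False using KL L0 gideal_zero[OF L] by auto
  qed
  then have "\<exists>S. gideal S \<and> P S" using L by blast
  from minimal[OF this] obtain S where S: "gideal S" "P S"
    and minS: "\<And>J. gideal J \<Longrightarrow> P J \<Longrightarrow> J \<subseteq> S \<Longrightarrow> J = S" by auto
  obtain a x0 where ax: "a \<in> K" "x0 \<in> S" "a * x0 \<noteq> 0" using S(2) P_def by blast
  \<comment> \<open>Some homogeneous component of \<open>x0\<close> survives multiplication by
    \<open>a\<close>; taking it as \<open>x\<close> makes \<open>K x\<close> graded.\<close>
  have "a * x0 = (\<Sum>n\<in>{n. p n x0 \<noteq> 0}. a * p n x0)"
    by (simp add: sum_comp sum_distrib_left[symmetric])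
  then obtain m where m: "a * p m x0 \<noteq> 0" using ax(3) by (metis (mono_tags, lifting) sum.neutral)
  define x where "x = p m x0"
  have x: "x \<in> S" "p m x = x" "a * x \<noteq> 0" using ax m gideal_comp[OF S(1)] by (auto simp: x_def comp_comp)
  have xZ: "x \<in> Z" using x gideal_subset[OF S(1)] by blast
  let ?Kx = "(\<lambda>a. a * x) ` K"
  \<comment> \<open>If \<open>K\<close> killed \<open>K x\<close>, then \<open>K K = K\<close> would
    kill \<open>x\<close>, contrary to \<open>a * x \<noteq> 0\<close>.\<close>
  have "P ?Kx"
  proof (rule ccontr)
    assume "\<not> P ?Kx"
    then have *: "b * (c * x) = 0" if "b \<in> K" "c \<in> K" for b c using that by (auto simp: P_def)
    have "b * x = 0" if "b \<in> prod_ideal K K" for b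
      using that by induction (auto simp: distrib_right mult.assoc *)
    then show False using KK ax(1) x(3) by simp
  qed
  moreover have "?Kx \<subseteq> S" using gideal_mult[OF S(1)] x(1) gideal_subset[OF K] by auto
  ultimately have "?Kx = S" by (intro minS gideal_mult_right[OF K xZ x(2)])
  then obtain k0 where k0: "k0 \<in> K" "x = k0 * x" using x(1) by blast
  \<comment> \<open>Comparing degree \<open>m\<close> components in \<open>x = k0 * x\<close> shows
    that the degree 0 part of \<open>k0\<close> already fixes \<open>x\<close>. Degree 0 also makes
    \<open>1 - k\<close> homogeneous.\<close>
  define k where "k = p 0 k0"
  have k: "k \<in> K" "p 0 k = k" using k0 gideal_comp[OF K] by (auto simp: k_def comp_comp)
  have kZ: "k \<in> Z" using k gideal_subset[OF K] by blast
  have kx: "k * x = x"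
    using comp_mult_homogeneous_right[OF x(2), of m k0] k0(2) x(2) by (simp add: k_def)
  let ?K1 = "(\<lambda>a. a * k) ` K" and ?K2 = "(\<lambda>a. a * (1 - k)) ` K"
  have "?K1 = K \<or> ?K2 = K"
  proof (rule hollowK)
    show "gideal ?K1" using gideal_mult_right[OF K kZ k(2)] .
    show "gideal ?K2"
      by (rule gideal_mult_right[OF K, of _ 0]) (use diff_Z one_Z kZ k in \<open>auto simp: comp_diff comp_one\<close>)
    show K1: "?K1 \<subseteq> K" using gideal_mult[OF K] gideal_subset[OF K] k by auto
    show "?K2 \<subseteq> K" using K1 gideal_diff[OF K] by (auto simp: right_diff_distrib)
    show "K \<subseteq> plus_ideal ?K1 ?K2"
    proof
      fix y assume "y \<in> K"
      then have "y * k + y * (1 - k) \<in> plus_ideal ?K1 ?K2" by (intro plus_idealI imageI)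
      then show "y \<in> plus_ideal ?K1 ?K2" by (simp add: right_diff_distrib)
    qed
  qed
  moreover have "?K2 \<noteq> K"
  proof
    assume "?K2 = K"
    then obtain b where "a = b * (1 - k)" using ax(1) by blast
    then have "a * x = b * ((1 - k) * x)" by (simp add: mult.assoc)
    also have "(1 - k) * x = 0" using kx by (simp add: left_diff_distrib)
    finally show False using x(3) by simp
  qed
  ultimately have "?K1 = K" by blast
  moreover have "(\<lambda>a. a * k) ` Z \<subseteq> K" using gideal_mult[OF K] k by blast
  ultimately have "K = (\<lambda>a. a * k) ` Z" using gideal_subset[OF K] by blast
  then show thesis by (rule that[OF k])
qed

text \<open>The minimum principle serves three families: non-Noetherian ideals, ideals
  \<open>T\<close> with \<open>T L = L\<close>, and, inside
  \<open>minimal_multiplier_cyclic\<close>, ideals not annihilated by \<open>K\<close>. Quotient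
  modules are replaced by computations modulo \<open>T\<close> and \<open>C\<close>.\<close>

theorem graded_hopkins:
  assumes minimal: "\<And>P. (\<exists>I. gideal I \<and> P I) \<Longrightarrow>
      \<exists>I. gideal I \<and> P I \<and> (\<forall>J. gideal J \<longrightarrow> P J \<longrightarrow> J \<subseteq> I \<longrightarrow> J = I)"
  shows "noeth Z"
proof (rule ccontr)
  assume "\<not> noeth Z"
  then have "\<exists>I. gideal I \<and> \<not> noeth I" using gideal_Z by blast
  from minimal[OF this] obtain L where L: "gideal L" and nL: "\<not> noeth L"
    and minL: "\<And>J. gideal J \<Longrightarrow> J \<subseteq> L \<Longrightarrow> J \<noteq> L \<Longrightarrow> noeth J"
    by auto
  \<comment> \<open>Two proper summands would be Noetherian by minimality of \<open>L\<close>, hence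
    so would their sum.\<close>
  have hollow: "A = L \<or> B = L" if AB: "gideal A" "gideal B" "plus_ideal A B = L" for A B
  proof (rule ccontr)
    assume "\<not> ?thesis"
    moreover have "A \<subseteq> L" "B \<subseteq> L" using AB plus_ideal_left plus_ideal_right by blast+
    ultimately have "noeth A" "noeth B" using minL AB by blast+
    then show False using noeth_plus[of A B] AB nL by simp
  qed
  \<comment> \<open>The union of a non-stabilizing chain in \<open>L\<close> would miss the
    generator \<open>x\<close>, hence be a proper and so Noetherian subideal; yet it contains that
    chain.\<close>
  have noncyclic: "(\<lambda>a. a * x) ` Z \<noteq> L" for x
  proof
    assume x: "(\<lambda>a. a * x) ` Z = L"
    then have xL: "x \<in> L" using self_mem_cyclic by blast
    obtain I where I: "\<And>k. gideal (I k)" "\<And>k. I k \<subseteq> L" "\<And>k. I k \<subseteq> I (Suc k)"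
      and ns: "\<not> (\<exists>N. \<forall>k\<ge>N. I k = I N)"
      using nL unfolding noeth_def by blast
    have mono: "I i \<subseteq> I j" if "i \<le> j" for i j using lift_Suc_mono_le[of I] I(3) that by blast
    have gU: "gideal (\<Union>(range I))"
      by (rule gideal_Union_chain) (use I(1) mono in \<open>auto, metis nle_le subsetD\<close>)
    have "\<Union>(range I) \<noteq> L"
    proof
      assume "\<Union>(range I) = L"
      then obtain k where "x \<in> I k" using xL by blast
      then have "L \<subseteq> I k" using x gideal_mult[OF I(1)] by blast
      then have "\<forall>j\<ge>k. I j = I k" using mono I(2) by blast
      then show False using ns by blast
    qed
    then have "noeth (\<Union>(range I))" using minL gU I(2) by blast
    then show False using ns I(1,3) unfolding noeth_def by blast
  qed
  have L0: "L \<noteq> {0}" using noncyclic[of 0] one_Z by auto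
  have "prod_ideal Z L = L"
  proof
    show "prod_ideal Z L \<subseteq> L" using prod_ideal_subset[OF L] gideal_mult[OF L] by blast
    show "L \<subseteq> prod_ideal Z L" using prod_ideal.mult[OF one_Z] by fastforce
  qed
  then have "\<exists>T. gideal T \<and> prod_ideal T L = L" using gideal_Z by blast
  from minimal[OF this] obtain K where K: "gideal K" and KL: "prod_ideal K L = L"
    and minK: "\<And>T. gideal T \<Longrightarrow> T \<subseteq> K \<Longrightarrow> prod_ideal T L = L \<Longrightarrow> T = K"
    by auto
  obtain k where k: "k \<in> K" "p 0 k = k" "K = (\<lambda>a. a * k) ` Z"
    by (rule minimal_multiplier_cyclic[OF K L KL L0 minK hollow minimal])
  have k0: "k \<noteq> 0"
  proof
    assume k0: "k = 0"
    have "x = 0" if "x \<in> prod_ideal K L" for x using that by induction (auto simp: k(3) k0)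
    then show False using KL L0 gideal_zero[OF L] by auto
  qed
  have g0: "gideal {0}" by (rule gidealI) (use gideal_zero[OF gideal_Z] in auto)
  have "{0} \<subseteq> K" "k \<notin> {0}" using k0 gideal_zero[OF K] by auto
  \<comment> \<open>Since \<open>K = Z k\<close>, avoiding \<open>k\<close> means being proper:
    \<open>T\<close> is a maximal graded subideal and \<open>K / T\<close> is graded simple.\<close>
  from exists_maximal_gideal_avoiding[OF g0 this] obtain T where T: "gideal T" "{0} \<subseteq> T" "T \<subseteq> K" "k \<notin> T"
    and maxT: "\<And>D. gideal D \<Longrightarrow> T \<subseteq> D \<Longrightarrow> D \<subseteq> K \<Longrightarrow> k \<notin> D \<Longrightarrow> D = T"
    by auto
  let ?TL = "prod_ideal T L"
  have gTL: "gideal ?TL" using gideal_prod T L by blast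
  have TLs: "?TL \<subseteq> L" using prod_ideal_subset[OF L] gideal_mult[OF L] gideal_subset[OF T(1)] by blast
  have TL: "?TL \<noteq> L" using minK[OF T(1,3)] T(4) k(1) by blast
  \<comment> \<open>As \<open>L = K L = Z k L\<close>, it suffices to test products of
    \<open>k\<close> with homogeneous elements of \<open>L\<close>. For \<open>D = T L\<close> this
    produces \<open>m0\<close> with \<open>k * m0\<close> outside \<open>T L\<close>; for
    \<open>D = Z l + C\<close> it later gives \<open>L = Z l + C\<close>.\<close>
  have kL: "L \<subseteq> D" if D: "gideal D" "\<And>m n. m \<in> L \<Longrightarrow> p n m = m \<Longrightarrow> k * m \<in> D" for D
  proof -
    have "k * b \<in> D" if "b \<in> L" for b
    proof -
      have "k * b = (\<Sum>n\<in>{n. p n b \<noteq> 0}. k * p n b)"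
        by (simp add: sum_comp sum_distrib_left[symmetric])
      also have "\<dots> \<in> D"
        by (intro gideal_sum D(1)) (rule D(2), use gideal_comp[OF L that] in \<open>auto simp: comp_comp\<close>)
      finally show ?thesis .
    qed
    then have "a * b \<in> D" if "a \<in> K" "b \<in> L" for a b
      using that gideal_mult[OF D(1)] by (auto simp: k(3) mult.assoc)
    then show ?thesis using prod_ideal_subset[OF D(1)] KL by metis
  qed
  then obtain m0 q where m0: "m0 \<in> L" "p q m0 = m0" "k * m0 \<notin> ?TL"
    using TL TLs gTL by (metis subset_antisym)
  define l where "l = k * m0"
  have kZ: "k \<in> Z" using k gideal_subset[OF K] by blast
  have lL: "l \<in> L" using gideal_mult[OF L kZ] m0 l_def by simp
  have lZ: "l \<in> Z" using lL gideal_subset[OF L] by blast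
  have lq: "p q l = l" using comp_mult_homogeneous_right[OF m0(2), of q k] k(2) by (simp add: l_def)
  have "l \<notin> ?TL" using m0(3) l_def by simp
  \<comment> \<open>Modulo \<open>T L\<close>, each homogeneous \<open>m\<close> makes
    \<open>Z k m\<close> a quotient of the simple \<open>K / T\<close>, and these modules generate
    \<open>L\<close>. So \<open>C\<close> acts as a complement of the one generated by
    \<open>l\<close>.\<close>
  from exists_maximal_gideal_avoiding[OF gTL TLs this] obtain C where C: "gideal C" "?TL \<subseteq> C" "C \<subseteq> L" "l \<notin> C"
    and maxC: "\<And>D. gideal D \<Longrightarrow> C \<subseteq> D \<Longrightarrow> D \<subseteq> L \<Longrightarrow> l \<notin> D \<Longrightarrow> D = C"
    by auto
  let ?Zl = "(\<lambda>a. a * l) ` Z"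
  have gZl: "gideal ?Zl" using gideal_mult_right[OF gideal_Z lZ lq] .
  have ZlL: "?Zl \<subseteq> L" using gideal_mult[OF L _ lL] by blast
  let ?D = "plus_ideal ?Zl C"
  have gD: "gideal ?D" using gideal_plus gZl C by blast
  have "L \<subseteq> ?D"
  proof (rule kL[OF gD])
    fix m n assume m: "m \<in> L" "p n m = m"
    let ?km = "k * m"
    have kmL: "?km \<in> L" using gideal_mult[OF L kZ m(1)] .
    have kmZ: "?km \<in> Z" using kmL gideal_subset[OF L] by blast
    have kmn: "p n ?km = ?km" using comp_mult_homogeneous_right[OF m(2), of n k] k(2) by simp
    show "?km \<in> ?D"
    proof (cases "?km \<in> C")
      case True
      then show ?thesis using plus_ideal_right[OF gZl] by blast
    next
      case False
      let ?E = "plus_ideal ((\<lambda>a. a * ?km) ` Z) C"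
      have gkm: "gideal ((\<lambda>a. a * ?km) ` Z)" using gideal_mult_right[OF gideal_Z kmZ kmn] .
      have kmE: "?km \<in> ?E" by (rule plus_ideal_left[OF C(1) self_mem_cyclic])
      have "l \<in> ?E"
      proof (rule ccontr)
        assume "l \<notin> ?E"
        moreover have "?E \<subseteq> L"
          by (rule plus_ideal_subset[OF L _ C(3)]) (use gideal_mult[OF L _ kmL] in auto)
        moreover have "C \<subseteq> ?E" using plus_ideal_right[OF gkm] by blast
        ultimately have "?E = C" by (intro maxC gideal_plus gkm C(1))
        then show False using kmE False by blast
      qed
      then obtain r0 c0 where r0: "r0 \<in> Z" "c0 \<in> C" "l = r0 * ?km + c0" by (auto elim!: plus_idealE)
      \<comment> \<open>Passing to degree \<open>q\<close> makes \<open>r\<close> homogeneous of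
        degree \<open>q - n\<close>, so that \<open>r * k\<close> generates a graded ideal.\<close>
      define r c where "r = p (q - n) r0" and "c = p q c0"
      have rZ: "r \<in> Z" and cC: "c \<in> C" using r0 comp_Z gideal_comp[OF C(1)] by (auto simp: r_def c_def)
      have lrc: "l = r * ?km + c"
        using lq comp_add[of q "r0 * ?km" c0] comp_mult_homogeneous_right[OF kmn, of q r0]
        by (simp add: r0(3)[symmetric] r_def c_def)
      have rkh: "p (q - n) (r * k) = r * k"
        using comp_mult_homogeneous_right[OF k(2), of "q - n" r] by (simp add: r_def comp_comp)
      have rkZ: "r * k \<in> Z" using mult_Z rZ kZ by blast
      have rkT: "r * k \<notin> T"
      proof
        assume "r * k \<in> T"
        then have "r * k * m \<in> C" using prod_ideal.mult[OF _ m(1)] C(2) by blast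
        then have "l \<in> C" using gideal_add[OF C(1) _ cC] by (simp add: lrc mult.assoc)
        then show False using C(4) by blast
      qed
      \<comment> \<open>As \<open>r * k\<close> is outside \<open>T\<close>, maximality of
        \<open>T\<close> gives \<open>k = s * (r * k) + t\<close>. This inverts \<open>r\<close>
        modulo \<open>T\<close> and turns \<open>l = r * (k * m) + c\<close> into an expression of
        \<open>k * m\<close> as \<open>s * l\<close> modulo \<open>C\<close>.\<close>
      let ?H = "plus_ideal ((\<lambda>a. a * (r * k)) ` Z) T"
      have grk: "gideal ((\<lambda>a. a * (r * k)) ` Z)" using gideal_mult_right[OF gideal_Z rkZ rkh] .
      have "k \<in> ?H"
      proof (rule ccontr)
        assume "k \<notin> ?H"
        moreover have "(\<lambda>a. a * (r * k)) ` Z \<subseteq> K"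
          using gideal_mult[OF K] rZ k(1) by blast
        then have "?H \<subseteq> K" by (rule plus_ideal_subset[OF K _ T(3)])
        moreover have "T \<subseteq> ?H" using plus_ideal_right[OF grk] by blast
        ultimately have "?H = T" by (intro maxT gideal_plus grk T(1))
        moreover have "r * k \<in> ?H" by (rule plus_ideal_left[OF T(1) self_mem_cyclic])
        ultimately show False using rkT by blast
      qed
      then obtain s t where st: "s \<in> Z" "t \<in> T" "k = s * (r * k) + t" by (auto elim!: plus_idealE)
      have "?km = (s * (r * k) + t) * m" using st(3) by simp
      also have "\<dots> = s * (r * ?km) + t * m" by (simp add: distrib_right mult.assoc)
      also have "r * ?km = l - c" using lrc by simp
      also have "s * (l - c) + t * m = s * l + (t * m - s * c)" by (simp add: right_diff_distrib)
      also have "\<dots> \<in> ?D"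
      proof (rule plus_idealI)
        show "s * l \<in> ?Zl" using st by blast
        have "t * m \<in> C" using prod_ideal.mult[OF st(2) m(1)] C(2) by blast
        then show "t * m - s * c \<in> C" using gideal_diff[OF C(1)] gideal_mult[OF C(1) st(1) cC] by blast
      qed
      finally show ?thesis .
    qed
  qed
  then have "?D = L" using plus_ideal_subset[OF L ZlL C(3)] by blast
  then have "?Zl = L \<or> C = L" by (rule hollow[OF gZl C(1)])
  then show False using noncyclic C(4) lL by blast
qed

end

section \<open>Cycles of a dg-algebra\<close>

definition hcomp :: "(int \<Rightarrow> 'a::ring_1 set) \<Rightarrow> int \<Rightarrow> 'a \<Rightarrow> 'a" where
  "hcomp G n a = (THE c. graded_decomp G a c) n"

locale dg_alg =
  fixes sm :: "'r::comm_ring_1 \<Rightarrow> 'a::ring_1 \<Rightarrow> 'a"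
    and G :: "int \<Rightarrow> 'a set" and d :: "'a \<Rightarrow> 'a"
  assumes dg: "dg_algebra sm G d"
begin

abbreviation "p \<equiv> hcomp G"

lemma graded_r_algebra: "graded_r_algebra sm G"
  using dg unfolding dg_algebra_def by (rule conjunct1)

lemma G_zero: "0 \<in> G n"
  using graded_r_algebra unfolding graded_r_algebra_def by simp

lemma G_add: "a \<in> G n \<Longrightarrow> b \<in> G n \<Longrightarrow> a + b \<in> G n"
  using graded_r_algebra unfolding graded_r_algebra_def by simp

lemma G_mult: "a \<in> G m \<Longrightarrow> b \<in> G n \<Longrightarrow> a * b \<in> G (m + n)"
  using graded_r_algebra unfolding graded_r_algebra_def by simp

lemma ex1_decomp: "\<exists>!c. graded_decomp G a c"
  using graded_r_algebra unfolding graded_r_algebra_def by (elim conjE) (erule spec)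

lemma d_add: "d (a + b) = d a + d b"
  using dg unfolding dg_algebra_def by simp

lemma d_G: "a \<in> G n \<Longrightarrow> d a \<in> G (n + 1)"
  using dg unfolding dg_algebra_def by simp

lemma d_d [simp]: "d (d a) = 0"
  using dg unfolding dg_algebra_def by simp

lemma Leibniz: "a \<in> G m \<Longrightarrow> b \<in> G n \<Longrightarrow> d (a * b) = d a * b + (- 1) ^ nat \<bar>m\<bar> * a * d b"
  using dg unfolding dg_algebra_def by (elim conjE) (drule spec, drule spec, drule bspec, assumption, drule bspec)

lemma decomp_hcomp: "graded_decomp G a (\<lambda>n. p n a)"
  using theI'[OF ex1_decomp[of a]] unfolding hcomp_def .

lemma hcomp_unique: "graded_decomp G a c \<Longrightarrow> p n a = c n"
  using ex1_decomp[of a] decomp_hcomp[of a] by metis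

lemma
  shows finite_hcomp: "finite {n. p n a \<noteq> 0}" and hcomp_G: "p n a \<in> G n"
    and sum_hcomp: "(\<Sum>n\<in>{n. p n a \<noteq> 0}. p n a) = a"
  using decomp_hcomp[of a] unfolding graded_decomp_def by auto

text \<open>\<open>F\<close> may exceed the support of \<open>c\<close>, which avoids computing the
  exact support of a sum or product.\<close>

lemma hcomp_eqI:
  assumes "finite F" "\<And>n. c n \<in> G n" "\<And>n. n \<notin> F \<Longrightarrow> c n = 0" "a = (\<Sum>n\<in>F. c n)"
  shows "p n a = c n"
proof (rule hcomp_unique)
  have "{n. c n \<noteq> 0} \<subseteq> F" using assms(3) by blast
  then show "graded_decomp G a c"
    unfolding graded_decomp_def using assms
    by (auto intro: finite_subset sum.mono_neutral_right)
qed

lemma sum_hcomp_superset: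
  assumes "finite F" "{n. p n a \<noteq> 0} \<subseteq> F"
  shows "(\<Sum>n\<in>F. p n a) = a"
  using sum.mono_neutral_left[OF assms, of "\<lambda>n. p n a"] sum_hcomp by simp

lemma hcomp_homogeneous: "a \<in> G m \<Longrightarrow> p n a = (if n = m then a else 0)"
  by (rule hcomp_eqI[of "{m}"]) (auto simp: G_zero)

lemma hcomp_add: "p n (a + b) = p n a + p n b"
proof (rule hcomp_eqI[where c = "\<lambda>n. p n a + p n b"])
  let ?F = "{n. p n a \<noteq> 0} \<union> {n. p n b \<noteq> 0}"
  show fin: "finite ?F" by (simp add: finite_hcomp)
  show "a + b = (\<Sum>n\<in>?F. p n a + p n b)"
    using sum_hcomp_superset[OF fin Un_upper1] sum_hcomp_superset[OF fin Un_upper2]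
    by (simp only: sum.distrib)
  show "p n a + p n b \<in> G n" for n by (intro G_add hcomp_G)
  show "p n a + p n b = 0" if "n \<notin> ?F" for n using that by simp
qed

lemma hcomp_mult_homogeneous_left:
  assumes "x \<in> G i" shows "p n (x * y) = x * p (n - i) y"
proof (rule hcomp_eqI[where c = "\<lambda>n. x * p (n - i) y"])
  let ?F = "(\<lambda>j. i + j) ` {j. p j y \<noteq> 0}"
  show "finite ?F" by (simp add: finite_hcomp)
  show "x * p (n - i) y \<in> G n" for n using G_mult[OF assms hcomp_G[of "n - i" y]] by simp
  show "x * p (n - i) y = 0" if "n \<notin> ?F" for n
  proof -
    have "p (n - i) y = 0" using that image_eqI[of n "(+) i" "n - i"] by auto
    then show ?thesis by simp
  qed
  have "(\<Sum>n\<in>?F. x * p (n - i) y) = (\<Sum>j\<in>{j. p j y \<noteq> 0}. x * p j y)"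
    by (subst sum.reindex) (auto simp: inj_on_def)
  then show "x * y = (\<Sum>n\<in>?F. x * p (n - i) y)"
    by (simp add: sum_distrib_left[symmetric] sum_hcomp)
qed

lemma hcomp_mult_homogeneous_right:
  assumes "y \<in> G i" shows "p n (x * y) = p (n - i) x * y"
proof (rule hcomp_eqI[where c = "\<lambda>n. p (n - i) x * y"])
  let ?F = "(\<lambda>j. j + i) ` {j. p j x \<noteq> 0}"
  show "finite ?F" by (simp add: finite_hcomp)
  show "p (n - i) x * y \<in> G n" for n using G_mult[OF hcomp_G[of "n - i" x] assms] by simp
  show "p (n - i) x * y = 0" if "n \<notin> ?F" for n
  proof -
    have "p (n - i) x = 0" using that image_eqI[of n "\<lambda>j. j + i" "n - i"] by auto
    then show ?thesis by simp
  qed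
  have "(\<Sum>n\<in>?F. p (n - i) x * y) = (\<Sum>j\<in>{j. p j x \<noteq> 0}. p j x * y)"
    by (subst sum.reindex) (auto simp: inj_on_def)
  then show "x * y = (\<Sum>n\<in>?F. p (n - i) x * y)"
    by (simp add: sum_distrib_right[symmetric] sum_hcomp)
qed

text \<open>The Leibniz rule covers homogeneous elements only; additive identities derived from it
  extend to all elements this way.\<close>

lemma additive_eqI:
  assumes "\<And>a b. f (a + b) = f a + f b" "\<And>a b. g (a + b) = g a + g b"
    "\<And>n a. a \<in> G n \<Longrightarrow> f a = (g a :: 'a)"
  shows "f a = g a"
proof -
  have "f 0 = 0" "g 0 = 0" using assms(1)[of 0 0] assms(2)[of 0 0] by auto
  then have "f (\<Sum>n\<in>F. p n a) = g (\<Sum>n\<in>F. p n a)" for F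
    by (induction F rule: infinite_finite_induct) (auto simp: assms(1,2) assms(3)[OF hcomp_G])
  then show ?thesis using sum_hcomp by metis
qed

text \<open>For \<open>a\<close> of degree \<open>n\<close>, the degree \<open>n\<close> component
  of \<open>1 * a\<close> is \<open>p 0 1 * a\<close>. So \<open>p 0 1\<close> is a left identity
  and equals \<open>1\<close>.\<close>

lemma hcomp_one: "p 0 1 = 1"
proof -
  have "p 0 1 * x = x" for x
  proof (rule additive_eqI[of "\<lambda>x. p 0 1 * x" "\<lambda>x. x"])
    show "p 0 1 * a = a" if "a \<in> G n" for n a
      using hcomp_mult_homogeneous_right[OF that, of n 1] hcomp_homogeneous[OF that] by simp
  qed (simp_all add: distrib_left)
  from this[of 1] show ?thesis by simp
qed

lemma one_G: "1 \<in> G 0"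
  using hcomp_G[of 0 1] hcomp_one by simp

section \<open>The differential, and products with cycles\<close>

lemma d_zero [simp]: "d 0 = 0"
  using d_add[of 0 0] by simp

lemma d_minus: "d (- a) = - d a"
  using d_add[of a "- a"] by (simp add: eq_neg_iff_add_eq_0 add.commute)

lemma d_diff: "d (a - b) = d a - d b"
  using d_add[of a "- b"] d_minus by simp

lemma d_one: "d 1 = 0"
  using Leibniz[OF one_G one_G] by simp

lemma hcomp_d: "p n (d a) = d (p (n - 1) a)"
  by (rule additive_eqI[of "\<lambda>a. p n (d a)" "\<lambda>a. d (p (n - 1) a)"])
    (auto simp: d_add hcomp_add hcomp_homogeneous[OF d_G] hcomp_homogeneous)

text \<open>The signed term of the Leibniz rule vanishes on cycles, so \<open>d\<close> is right
  linear over them even for inhomogeneous \<open>a\<close>. The components of \<open>y\<close> are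
  cycles too, which allows a reduction to homogeneous factors.\<close>

lemma d_mult_cycle:
  assumes "d y = 0" shows "d (a * y) = d a * y"
proof -
  have cyc: "d (p n y) = 0" for n using hcomp_d[of "n + 1" y] assms hcomp_homogeneous[OF G_zero] by (simp split: if_splits)
  have "d (a * p n y) = d a * p n y" for n
  proof (rule additive_eqI[of "\<lambda>a. d (a * p n y)" "\<lambda>a. d a * p n y"])
    show "d (b * p n y) = d b * p n y" if "b \<in> G m" for m b
      using Leibniz[OF that hcomp_G, of n y] cyc by simp
  qed (simp_all add: d_add distrib_right)
  then have "d (a * (\<Sum>n\<in>F. p n y)) = d a * (\<Sum>n\<in>F. p n y)" for F
    by (induction F rule: infinite_finite_induct) (auto simp: d_add distrib_left)
  then show ?thesis using sum_hcomp by metis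
qed

lemma graded_subring_cycles: "graded_subring {a. d a = 0} p"
proof
  show "p n x \<in> {a. d a = 0}" if "x \<in> {a. d a = 0}" for n x
    using that hcomp_d[of "n + 1" x] hcomp_homogeneous[OF G_zero] by (simp split: if_splits)
qed (auto simp: d_one d_diff d_mult_cycle hcomp_add finite_hcomp sum_hcomp
    hcomp_homogeneous[OF hcomp_G] hcomp_one hcomp_mult_homogeneous_left[OF hcomp_G]
    hcomp_mult_homogeneous_right[OF hcomp_G])

sublocale cycles: graded_subring "{a. d a = 0}" p
  by (rule graded_subring_cycles)

lemma dg_ideal_hcomp: "dg_ideal G d I \<Longrightarrow> x \<in> I \<Longrightarrow> p n x \<in> I"
  unfolding dg_ideal_def using hcomp_unique by metis

end

section \<open>The contraction of an acyclic dg-algebra\<close>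

locale acyclic_dg_alg = dg_alg sm G d
  for sm :: "'r::comm_ring_1 \<Rightarrow> 'a::ring_1 \<Rightarrow> 'a" and G d +
  assumes acyclic: "dg_acyclic d"
begin

text \<open>Acyclicity makes the cycle \<open>1\<close> a boundary \<open>d v\<close>; comparing
  degree 0 components replaces \<open>v\<close> by its component of degree -1.\<close>

lemma exists_contraction: "\<exists>u. u \<in> G (- 1) \<and> d u = 1"
proof -
  obtain v where v: "1 = d v" using acyclic d_one unfolding dg_acyclic_def by blast
  have "d (p (- 1) v) = 1" using hcomp_d[of 0 v] v hcomp_one by simp
  then show ?thesis using hcomp_G by blast
qed

definition u where "u = (SOME u. u \<in> G (- 1) \<and> d u = 1)"

lemma u: "u \<in> G (- 1)" "d u = 1"
  using someI_ex[OF exists_contraction] unfolding u_def by auto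

text \<open>As \<open>u\<close> has odd degree, the Leibniz sign is -1: left multiplication by
  \<open>u\<close> is a contracting homotopy.\<close>

lemma d_u_mult: "d (u * x) = x - u * d x"
  by (rule additive_eqI[of "\<lambda>x. d (u * x)" "\<lambda>x. x - u * d x"])
    (auto simp: d_add distrib_left Leibniz[OF u(1)] u(2))

lemma contraction: "x = d (u * x) + u * d x"
  by (simp add: d_u_mult)

text \<open>By the contraction identity this is J + u J.\<close>
definition extend :: "'a set \<Rightarrow> 'a set" where
  "extend J = {x. d x \<in> J \<and> d (u * x) \<in> J}"

text \<open>The critical point is closure under multiplication by the whole algebra, while
  \<open>J\<close> absorbs only cycles. Contraction rewrites \<open>d (a * x)\<close> as a
  combination of \<open>d (u * x)\<close> and \<open>d x\<close>, both in \<open>J\<close>, with the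
  cycles \<open>d a\<close> and \<open>d (a * u)\<close> as coefficients.\<close>

lemma dg_ideal_extend:
  assumes J: "cycles.gideal J"
  shows "dg_ideal G d (extend J)"
proof -
  have mult: "d a * y \<in> J" if "y \<in> J" for a y using cycles.gideal_mult[OF J, of "d a" y] that by simp
  have dmult: "d (a * x) \<in> J" if x: "x \<in> extend J" for a x
  proof -
    have "a * x = a * d (u * x) + (a * u) * d x"
      by (subst contraction[of x]) (simp only: distrib_left mult.assoc)
    then have "d (a * x) = d a * d (u * x) + d (a * u) * d x"
      by (simp add: d_add d_mult_cycle)
    then show ?thesis using x mult cycles.gideal_add[OF J] by (simp add: extend_def)
  qed
  show ?thesis
    unfolding dg_ideal_def
  proof (intro conjI ballI allI)
    show "0 \<in> extend J" using cycles.gideal_zero[OF J] by (simp add: extend_def)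
    show "x + y \<in> extend J" if "x \<in> extend J" "y \<in> extend J" for x y
      using that cycles.gideal_add[OF J] by (simp add: extend_def d_add distrib_left)
    show "- x \<in> extend J" if "x \<in> extend J" for x
      using that cycles.gideal_minus[OF J] by (simp add: extend_def d_minus)
    show "a * x \<in> extend J" if "x \<in> extend J" for a x
      using dmult[OF that, of a] dmult[OF that, of "u * a"] by (simp add: extend_def mult.assoc)
    show "\<exists>c. graded_decomp G x c \<and> (\<forall>n. c n \<in> extend J)" if x: "x \<in> extend J" for x
    proof (intro exI conjI allI)
      show "graded_decomp G x (\<lambda>n. p n x)" by (rule decomp_hcomp)
      show "p n x \<in> extend J" for n
      proof -
        have "d (p n x) = p (n + 1) (d x)" by (simp add: hcomp_d)
        moreover have "d (u * p n x) = p n (d (u * x))"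
          by (simp add: hcomp_d hcomp_mult_homogeneous_left[OF u(1)])
        ultimately show ?thesis using x cycles.gideal_comp[OF J] by (simp add: extend_def)
      qed
    qed
    show "d x \<in> extend J" if "x \<in> extend J" for x
      using that cycles.gideal_zero[OF J] by (simp add: extend_def d_u_mult)
  qed
qed

text \<open>On a cycle \<open>x\<close> contraction reduces to \<open>d (u * x) = x\<close>, so the
  conditions defining \<open>extend J\<close> become \<open>0 \<in> J\<close> and
  \<open>x \<in> J\<close>.\<close>

lemma extend_cycles: "cycles.gideal J \<Longrightarrow> extend J \<inter> {a. d a = 0} = J"
  using cycles.gideal_subset[of J] cycles.gideal_zero[of J] by (auto simp: extend_def d_u_mult)

lemma gideal_cycles:
  assumes "dg_ideal G d I" shows "cycles.gideal (I \<inter> {a. d a = 0})"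
proof (rule cycles.gidealI)
  fix x y assume "x \<in> I \<inter> {a. d a = 0}" "y \<in> I \<inter> {a. d a = 0}"
  then show "x - y \<in> I \<inter> {a. d a = 0}"
    using assms unfolding dg_ideal_def by (auto simp: d_diff) (metis diff_conv_add_uminus)
qed (use assms dg_ideal_hcomp[OF assms] cycles.comp_Z in
    \<open>auto simp: dg_ideal_def d_mult_cycle\<close>)

text \<open>Both \<open>d x\<close> and \<open>d (u * x)\<close> are cycles and lie in
  \<open>I\<close> when \<open>x\<close> does; conversely, contraction rebuilds \<open>x\<close>
  from them.\<close>

lemma extend_of_cycles:
  assumes "dg_ideal G d I" shows "extend (I \<inter> {a. d a = 0}) = I"
proof
  show "extend (I \<inter> {a. d a = 0}) \<subseteq> I"
  proof
    fix x assume "x \<in> extend (I \<inter> {a. d a = 0})"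
    then have "d (u * x) + u * d x \<in> I"
      using assms by (simp add: extend_def dg_ideal_def)
    then show "x \<in> I" using contraction[of x] by simp
  qed
  show "I \<subseteq> extend (I \<inter> {a. d a = 0})"
    using assms unfolding dg_ideal_def by (auto simp: extend_def)
qed

text \<open>Dependent choice turns a failure of the minimum principle into a strictly descending
  sequence. Its image under \<open>extend\<close> is a chain of dg-ideals that stays strict because
  \<open>extend_cycles\<close> recovers the original.\<close>

lemma minimal_gideal_cycles:
  assumes art: "dg_artinian G d" and ex: "\<exists>I. cycles.gideal I \<and> P I"
  shows "\<exists>I. cycles.gideal I \<and> P I \<and> (\<forall>J. cycles.gideal J \<longrightarrow> P J \<longrightarrow> J \<subseteq> I \<longrightarrow> J = I)"
proof (rule ccontr)
  assume no: "\<not> ?thesis"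
  let ?Q = "\<lambda>I. cycles.gideal I \<and> P I"
  have "\<exists>f. \<forall>n. ?Q (f n) \<and> f (Suc n) \<subset> f n"
  proof (rule dependent_nat_choice)
    show "\<exists>I. ?Q I" by (rule ex)
    show "\<exists>J. ?Q J \<and> J \<subset> I" if "?Q I" for I and n :: nat using no that by blast
  qed
  then obtain f where f: "\<And>n::nat. ?Q (f n)" "\<And>n. f (Suc n) \<subset> f n" by blast
  have "\<forall>k. dg_ideal G d (extend (f k))" using f(1) dg_ideal_extend by blast
  moreover have "\<forall>k. extend (f (Suc k)) \<subseteq> extend (f k)" using f(2) unfolding extend_def by blast
  ultimately have "\<exists>N. \<forall>k\<ge>N. extend (f k) = extend (f N)"
    using art[unfolded dg_artinian_def, rule_format, of "\<lambda>k. extend (f k)"] by blast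
  then obtain N where "extend (f (Suc N)) = extend (f N)" by (meson le_Suc_eq order_refl)
  then have "f (Suc N) = f N" using extend_cycles f(1) by metis
  then show False using f(2) by blast
qed

text \<open>Intersection with the cycles gives a chain that \<open>graded_hopkins\<close>
  stabilizes; \<open>extend_of_cycles\<close> carries stability back.\<close>

lemma dg_noetherian_of_dg_artinian:
  assumes "dg_artinian G d" shows "dg_noetherian G d"
  unfolding dg_noetherian_def
proof (intro allI impI, elim conjE)
  fix I :: "nat \<Rightarrow> 'a set"
  assume I: "\<forall>k. dg_ideal G d (I k)" and inc: "\<forall>k. I k \<subseteq> I (Suc k)"
  let ?J = "\<lambda>k. I k \<inter> {a. d a = 0}"
  have "cycles.noeth {a. d a = 0}"
    by (rule cycles.graded_hopkins) (rule minimal_gideal_cycles[OF assms])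
  moreover have "\<forall>k. cycles.gideal (?J k) \<and> ?J k \<subseteq> {a. d a = 0}" using gideal_cycles I by blast
  moreover have "\<forall>k. ?J k \<subseteq> ?J (Suc k)" using inc by blast
  ultimately obtain N where "\<forall>k\<ge>N. ?J k = ?J N"
    unfolding cycles.noeth_def by meson
  then have "\<forall>k\<ge>N. I k = I N" using extend_of_cycles I by metis
  then show "\<exists>N. \<forall>k\<ge>N. I k = I N" by blast
qed

end

theorem theorem2p7:
  fixes sm :: "'r::comm_ring_1 \<Rightarrow> 'a::ring_1 \<Rightarrow> 'a"
    and G :: "int \<Rightarrow> 'a set" and d :: "'a \<Rightarrow> 'a"
  assumes "dg_algebra sm G d"
    and "dg_acyclic d"
    and "dg_artinian G d"
  shows "dg_noetherian G d"
proof -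
  interpret acyclic_dg_alg sm G d
    by unfold_locales (use assms in auto)
  show ?thesis by (rule dg_noetherian_of_dg_artinian[OF assms(3)])
qed

end
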